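(* Let $\alpha>1$ be a real algebraic number with at least one conjugate different from $\alpha$ itself lying outside the unit circle (i.e. having absolute value $>1$), and let $\eta$ be a real number such that $\widetilde{L}(\alpha)|\eta|<1$. (1) If $\xi\neq 0$ is a real number, then there exist $\delta_3\in(0,\frac12)$ depending only on $\alpha$ and $\eta$, and a constant $C=C(\alpha,\xi)>0$ depending only on $\alpha$ and $\xi$, such that $$\#\left\{1\leq n\leq N:\ \|\xi \alpha^{n}-\eta\|\geq\delta_3\right\}\geq \lfloor C\log N\rfloor$$ holds for all positive integers $N$. (2) Moreover, if $1\leq \xi\leq\alpha$, then there exist $\delta_4\in(0,\frac12)$ depending only on $\alpha$, and a constant $C=C(\alpha)>0$ depending only on $\alpha$ (so both are independent of $\xi\in[1,\alpha]$), such that $$\#\left\{1\leq n\leq N:\ \|\xi \alpha^{n}\|\geq\delta_4\right\}\geq \lfloor C\log N\rfloor$$ holds for all positive integers $N$.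
   Context: For a real number $x$, $\|x\|$ denotes the distance from $x$ to its nearest integer. In the counting sets, $n$ ranges over integers. For the real algebraic number $\alpha$, let $a_dx^d+a_{d-1}x^{d-1}+\cdots+a_1x+a_0\in\mathbb{Z}[x]$ be its minimal polynomial over $\mathbb{Z}$ (irreducible in $\mathbb{Z}[x]$, i.e. with coprime integer coefficients, of degree $d$). The conjugates of $\alpha$ are the complex roots of this polynomial. Define $\widetilde{L}(\alpha)=\left|\sum_{j=0}^d a_j\right|$. *)

theory Defs
  imports Complex_Main "HOL-Computational_Algebra.Computational_Algebra"
begin

text \<open>For \<open>x\<close> halfway between two integers both are nearest, and the value is \<open>1/2\<close>.\<close>

definition dist_int :: "real \<Rightarrow> real" where
  "dist_int x = \<bar>x - of_int (round x)\<bar>"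

lemma dist_int_le: "dist_int x \<le> \<bar>x - of_int m\<bar>"
  unfolding dist_int_def using round_diff_minimal[of x m] by simp

text \<open>Irreducibility of an integer polynomial vanishing at \<open>\<alpha>\<close> forces its coefficients
  to be coprime; the sign of the leading coefficient is the only remaining freedom, fixed here as
  positive. For algebraic \<open>\<alpha>\<close>, existence and uniqueness are shown below; otherwise the
  polynomial is unspecified.\<close>

definition min_int_poly :: "real \<Rightarrow> int poly" where
  "min_int_poly \<alpha> =
     (THE p. irreducible p \<and> lead_coeff p > 0 \<and> poly (map_poly of_int p) \<alpha> = 0)"

definition conjugates :: "real \<Rightarrow> complex set" where
  "conjugates \<alpha> = {z. poly (map_poly of_int (min_int_poly \<alpha>)) z = 0}"

definition L_tilde :: "real \<Rightarrow> real" where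
  "L_tilde \<alpha> =
     (let p = min_int_poly \<alpha> in of_int \<bar>\<Sum>j = 0..degree p. coeff p j\<bar>)"

lemma of_int_poly_mult:
  "map_poly of_int (p * q) = (map_poly of_int p * map_poly of_int q :: 'a::comm_ring_1 poly)"
  by (rule poly_eqI) (simp add: coeff_map_poly coeff_mult)

lemma of_int_poly_add:
  "map_poly of_int (p + q) = (map_poly of_int p + map_poly of_int q :: 'a::comm_ring_1 poly)"
  by (rule poly_eqI) (simp add: coeff_map_poly)

lemma of_int_poly_smult:
  "map_poly of_int (smult c p) = (smult (of_int c) (map_poly of_int p) :: 'a::comm_ring_1 poly)"
  by (rule poly_eqI) (simp add: coeff_map_poly)

lemma degree_pos_of_root:
  fixes p :: "int poly" and \<alpha> :: "'a::{idom,ring_char_0}"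
  assumes "p \<noteq> 0" "poly (map_poly of_int p) \<alpha> = 0"
  shows "degree p > 0"
proof (rule ccontr)
  assume "\<not> degree p > 0"
  then obtain c where "p = [:c:]" by (metis degree_eq_zeroE gr0I)
  with assms show False by (simp add: map_poly_pCons)
qed

lemma irreducible_int_poly_unique:
  fixes p q :: "int poly" and \<alpha> :: real
  assumes p: "irreducible p" "lead_coeff p > 0" "poly (map_poly of_int p) \<alpha> = 0"
    and q: "irreducible q" "lead_coeff q > 0" "poly (map_poly of_int q) \<alpha> = 0"
  shows "p = q"
proof -
  let ?P = "\<lambda>r :: int poly. r \<noteq> 0 \<and> poly (map_poly of_int r) \<alpha> = 0"
  have nz: "p \<noteq> 0" "q \<noteq> 0" using p(1) q(1) by auto
  have prm: "prime_elem p" "prime_elem q" using p(1) q(1) by (simp_all add: prime_elem_iff_irreducible)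
  define r where "r = arg_min degree ?P"
  have r: "?P r" and rmin: "\<And>s. ?P s \<Longrightarrow> degree r \<le> degree s"
    using arg_min_nat_lemma[of ?P p degree] nz p(3) unfolding r_def by auto
  have dr: "degree r > 0" using degree_pos_of_root r by blast
  have dvd: "s dvd r" if s: "prime_elem s" "poly (map_poly of_int s) \<alpha> = 0" for s :: "int poly"
  proof -
    obtain u t where ut: "pseudo_divmod s r = (u, t)" by fastforce
    define c where "c = coeff r (degree r) ^ (Suc (degree s) - degree r)"
    have eq: "smult c s = r * u + t" and t: "t = 0 \<or> degree t < degree r"
      using pseudo_divmod[OF _ ut] r unfolding c_def by auto
    have c: "c \<noteq> 0" using r by (simp add: c_def)
    have "poly (map_poly of_int (smult c s)) \<alpha> = poly (map_poly of_int (r * u + t)) \<alpha>"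
      using eq by simp
    then have "poly (map_poly of_int t) \<alpha> = 0"
      using r s(2) by (simp add: of_int_poly_mult of_int_poly_add of_int_poly_smult)
    then have t0: "t = 0" using t rmin[of t] by (cases "t = 0") auto
    have eq': "smult c s = r * u" using eq t0 by simp
    then have "s dvd r * u" by (metis dvd_smult dvd_refl)
    then consider "s dvd r" | "s dvd u" using s(1) prime_elem_dvd_mult_iff by blast
    then show ?thesis
    proof cases
      case 2
      then obtain v where v: "u = s * v" by (elim dvdE)
      have s0: "s \<noteq> 0" using s(1) by auto
      have "s * [:c:] = s * (r * v)" using eq' v by (simp add: mult_ac)
      then have rv: "[:c:] = r * v" using s0 by (metis mult_left_cancel)
      then have "v \<noteq> 0" using c by auto
      then have "degree [:c:] = degree r + degree v" using rv r by (simp add: degree_mult_eq)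
      then show ?thesis using dr by simp
    qed simp
  qed
  obtain u where u: "r = p * u" using dvd[OF prm(1) p(3)] by (elim dvdE)
  have "u \<noteq> 0" using u r by auto
  then have "degree r = degree p + degree u" using u nz by (simp add: degree_mult_eq)
  moreover have "degree r \<le> degree p" using rmin nz p(3) by blast
  ultimately have du: "degree u = 0" by simp
  have "q dvd p * u" using dvd[OF prm(2) q(3)] u by simp
  moreover have "\<not> q dvd u"
    using degree_pos_of_root[OF nz(2) q(3)] du \<open>u \<noteq> 0\<close> dvd_imp_degree_le[of q u] by auto
  ultimately have "q dvd p" using prm(2) prime_elem_dvd_mult_iff by blast
  then obtain w where w: "p = q * w" by (elim dvdE)
  have "w dvd 1" using irreducibleD[OF p(1) w] q(1) by (auto simp: irreducible_not_unit)
  then obtain c where c: "w = [:c:]" "c dvd 1" by (auto simp: is_unit_poly_iff)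
  then have "lead_coeff p = lead_coeff q * c" using w by simp
  then have "c > 0" using p(2) q(2) by (metis zero_less_mult_pos)
  then have "c = 1" using c(2) by simp
  then show ?thesis using w c by simp
qed

lemma irreducible_int_poly_exists:
  fixes \<alpha> :: real
  assumes "algebraic \<alpha>"
  shows "\<exists>p :: int poly. irreducible p \<and> lead_coeff p > 0 \<and> poly (map_poly of_int p) \<alpha> = 0"
proof -
  obtain P :: "real poly" where P: "\<And>i. coeff P i \<in> \<int>" "P \<noteq> 0" "poly P \<alpha> = 0"
    using algebraicE[OF assms] by metis
  define f :: "int poly" where "f = map_poly floor P"
  have Pf: "P = map_poly of_int f"
    using P(1) by (intro poly_eqI) (simp add: f_def coeff_map_poly)
  then have "f \<noteq> 0" "poly (map_poly of_int f) \<alpha> = 0" using P by auto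
  then have "\<exists>p. prime_elem p \<and> poly (map_poly of_int p) \<alpha> = 0"
  proof (induction f rule: prime_divisors_induct)
    case (unit x)
    then obtain c where "x = [:c:]" "c \<noteq> 0" by (auto simp: is_unit_poly_iff)
    with unit show ?case by (simp add: map_poly_pCons)
  next
    case (factor p x)
    then show ?case by (auto simp: of_int_poly_mult)
  qed simp
  then obtain p :: "int poly" where p: "prime_elem p" "poly (map_poly of_int p) \<alpha> = 0" by blast
  show ?thesis
  proof (cases "lead_coeff p > 0")
    case True
    with p show ?thesis by (auto simp: prime_elem_iff_irreducible)
  next
    case False
    have "lead_coeff p \<noteq> 0" using p(1) by auto
    then have "lead_coeff p < 0" using False by linarith
    then have "lead_coeff (- p) > 0" by simp
    moreover have "irreducible (- p)"
      using p(1) irreducible_mult_unit_left[of "-1" p] by (simp add: prime_elem_iff_irreducible)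
    moreover have "poly (map_poly of_int (- p)) \<alpha> = 0"
      using p(2) of_int_poly_smult[of "-1" p, where ?'a = real] by simp
    ultimately show ?thesis by blast
  qed
qed

lemma min_int_poly:
  assumes "algebraic \<alpha>"
  shows "irreducible (min_int_poly \<alpha>)" "lead_coeff (min_int_poly \<alpha>) > 0"
    "poly (map_poly of_int (min_int_poly \<alpha>)) \<alpha> = 0"
proof -
  have "\<exists>!p :: int poly. irreducible p \<and> lead_coeff p > 0 \<and> poly (map_poly of_int p) \<alpha> = 0"
    using irreducible_int_poly_exists[OF assms] irreducible_int_poly_unique by blast
  from theI'[OF this] show "irreducible (min_int_poly \<alpha>)"
    "lead_coeff (min_int_poly \<alpha>) > 0"
    "poly (map_poly of_int (min_int_poly \<alpha>)) \<alpha> = 0"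
    unfolding min_int_poly_def by blast+
qed

end

theory Submission
  imports Defs
begin

text \<open>
  Let \<open>p = \<Sum>j\<le>d. a\<^sub>j x\<^sup>j\<close> be the minimal polynomial of \<open>\<alpha>\<close>, let \<open>\<beta>\<close> be a
  second root outside the unit circle, and let \<open>u n\<close> be the integer nearest to
  \<open>\<xi> * \<alpha> ^ n - \<eta>\<close>. The idea is that a long run of indices \<open>n\<close> at which
  \<open>\<xi> * \<alpha> ^ n - \<eta>\<close> is close to \<open>u n\<close> would make \<open>u\<close> satisfy the linear recurrence
  of \<open>p\<close> exactly, and the component of \<open>u\<close> along \<open>\<beta> ^ n\<close> would then have to grow
  exponentially, although it is bounded.

  In detail, applying the recurrence operator of \<open>p\<close> to \<open>\<xi> * \<alpha> ^ n - \<eta>\<close> gives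
  \<open>- \<eta> * p(1)\<close>, which has absolute value less than 1 because \<open>L_tilde \<alpha> = \<bar>p(1)\<bar>\<close>.
  If the rounding errors are below a small threshold, then \<open>\<Sum>j\<le>d. a\<^sub>j * u (n + j)\<close> is an
  integer of absolute value less than 1, hence 0 (\<open>integer_recurrence_if_close\<close>).

  The component along \<open>\<beta> ^ n\<close> is extracted by the operator \<open>p(x) / (x - \<beta>)\<close>, which
  is \<open>eigen_part p \<beta>\<close>. Wherever the recurrence holds, this component is multiplied by
  \<open>\<beta>\<close> in each step (\<open>eigen_part_Suc\<close>). The same operator kills \<open>\<alpha> ^ n\<close>
  (\<open>eigen_part_other_root\<close>), so that it only sees the bounded difference
  \<open>u n - \<xi> * \<alpha> ^ n\<close>, and its value stays below a constant depending on \<open>\<alpha>\<close> and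
  \<open>\<beta>\<close> only.

  At the start \<open>m\<close> of a run the component is \<open>G(\<beta>)\<close> for an integer polynomial \<open>G\<close> of
  degree less than \<open>d\<close> with coefficients of size \<open>O(\<alpha> ^ m)\<close>, and \<open>G \<noteq> 0\<close> as soon as
  \<open>u m \<noteq> 0\<close>. A Liouville inequality (\<open>int_poly_at_root_lower_bound\<close>) gives
  \<open>\<bar>G(\<beta>)\<bar> \<ge> c * \<alpha> ^ (- k * m)\<close>. Since \<open>\<bar>\<beta>\<bar> > 1\<close>, a run starting at \<open>m\<close> has length
  \<open>O(m)\<close> (\<open>far_index_in_window\<close>). Thus for a suitable \<open>F\<close> each of the intervals
  \<open>{F ^ i..<F ^ (i + 1)}\<close> contains an index that is far from the integers, and about
  \<open>ln N / ln F\<close> of these intervals lie below \<open>N\<close>. The ratio \<open>F\<close> depends on \<open>\<xi>\<close> only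
  through an upper and a positive lower bound for \<open>\<bar>\<xi>\<bar>\<close>, and not on \<open>\<eta>\<close>, as
  \<open>\<bar>\<eta>\<bar> < 1\<close> always holds; this yields both parts of the theorem at once.
\<close>

section \<open>Integer polynomials at algebraic numbers\<close>

abbreviation int_poly_at :: "int poly \<Rightarrow> 'a::comm_ring_1 \<Rightarrow> 'a" where
  "int_poly_at p z \<equiv> poly (map_poly of_int p) z"

lemma int_poly_at_altdef:
  fixes z :: "'a::{comm_ring_1,ring_char_0}"
  assumes "degree p \<le> n"
  shows "int_poly_at p z = (\<Sum>j<Suc n. of_int (coeff p j) * z ^ j)"
proof -
  have "degree (map_poly of_int p :: 'a poly) \<le> n"
    using assms by (intro degree_le) (simp add: coeff_map_poly coeff_eq_0)
  then have "int_poly_at p z = (\<Sum>j<Suc n. coeff (map_poly of_int p) j * z ^ j)"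
    unfolding poly_altdef lessThan_Suc_atMost
    by (intro sum.mono_neutral_left) (auto simp: coeff_eq_0)
  then show ?thesis by (simp add: coeff_map_poly)
qed

text \<open>Pseudo-division of \<open>p\<close> by an integer polynomial \<open>r\<close> of least degree vanishing at \<open>z\<close>
  leaves no remainder, so the prime element \<open>p\<close> divides \<open>r\<close> or the quotient; the latter would
  make \<open>r\<close> constant.\<close>

lemma irreducible_degree_le:
  fixes p q :: "int poly" and z :: "'a::{idom,ring_char_0}"
  assumes p: "irreducible p" "int_poly_at p z = 0"
    and q: "q \<noteq> 0" "int_poly_at q z = 0"
  shows "degree p \<le> degree q"
proof -
  let ?R = "\<lambda>r :: int poly. r \<noteq> 0 \<and> int_poly_at r z = 0"
  define r where "r = arg_min degree ?R"
  have r: "?R r" and rmin: "\<And>s. ?R s \<Longrightarrow> degree r \<le> degree s"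
    using arg_min_nat_lemma[of ?R q degree] q unfolding r_def by auto
  obtain u t where ut: "pseudo_divmod p r = (u, t)" by fastforce
  define c where "c = coeff r (degree r) ^ (Suc (degree p) - degree r)"
  have eq: "smult c p = r * u + t" and t: "t = 0 \<or> degree t < degree r"
    using pseudo_divmod[OF _ ut] r unfolding c_def by auto
  have c: "c \<noteq> 0" using r by (simp add: c_def)
  have "int_poly_at (smult c p) z = int_poly_at (r * u + t) z"
    using eq by simp
  then have "int_poly_at t z = 0"
    using r p(2) by (simp add: of_int_poly_mult of_int_poly_add of_int_poly_smult)
  then have eq': "smult c p = r * u"
    using eq t rmin[of t] by (cases "t = 0") auto
  have prime: "prime_elem p" using p(1) by (simp add: prime_elem_iff_irreducible)
  have p0: "p \<noteq> 0" using p(1) by auto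
  have "p dvd r * u" using eq' by (metis dvd_smult dvd_refl)
  then consider "p dvd r" | "p dvd u" using prime prime_elem_dvd_mult_iff by blast
  then show ?thesis
  proof cases
    case 1
    then have "degree p \<le> degree r" using r dvd_imp_degree_le by blast
    also have "\<dots> \<le> degree q" using rmin q by blast
    finally show ?thesis .
  next
    case 2
    then obtain v where v: "u = p * v" by (elim dvdE)
    have "p * [:c:] = p * (r * v)" using eq' v by (simp add: mult_ac)
    then have rv: "[:c:] = r * v" using p0 by (metis mult_left_cancel)
    then have "v \<noteq> 0" using c by auto
    then have "degree [:c:] = degree r + degree v" using rv r by (simp add: degree_mult_eq)
    then show ?thesis using degree_pos_of_root[of r z] r by simp
  qed
qed

section \<open>A Liouville inequality\<close>

definition height_le :: "int poly \<Rightarrow> real \<Rightarrow> bool" where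
  "height_le p H \<longleftrightarrow> (\<forall>i. \<bar>real_of_int (coeff p i)\<bar> \<le> H)"

lemma height_leD: "height_le p H \<Longrightarrow> \<bar>real_of_int (coeff p i)\<bar> \<le> H"
  by (simp add: height_le_def)

lemma height_le_mono: "height_le p H \<Longrightarrow> H \<le> H' \<Longrightarrow> height_le p H'"
  unfolding height_le_def using order_trans by blast

lemma norm_const_int_poly_at_ge_1:
  fixes z :: complex
  assumes "degree p = 0" "p \<noteq> 0"
  shows "norm (int_poly_at p z) \<ge> 1"
proof -
  obtain a where a: "p = [:a:]" "a \<noteq> 0" using assms by (metis degree_eq_zeroE pCons_0_0)
  then have "\<bar>a\<bar> \<ge> 1" by linarith
  then have "\<bar>real_of_int a\<bar> \<ge> 1" by linarith
  then show ?thesis using a by (simp add: map_poly_pCons)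
qed

text \<open>Cancelling the leading terms of \<open>A\<close> and \<open>B\<close>, without dividing, keeps the coefficients
  integral, bounds the new height polynomially in the old one, and keeps the pair free of common
  roots because the multiplier of \<open>A\<close> is a nonzero integer. Smallness of \<open>A\<close> and \<open>B\<close> at
  \<open>z\<close> is passed on to the new pair up to a factor polynomial in \<open>H\<close>.\<close>

lemma euclid_step:
  fixes A B :: "int poly" and z :: complex
  assumes deg: "degree B \<le> degree A" "degree A > 0"
    and "B \<noteq> 0"
    and "height_le A H" "height_le B H" "H \<ge> 1"
    and coprime: "\<And>x::complex. int_poly_at A x \<noteq> 0 \<or> int_poly_at B x \<noteq> 0"
  obtains R where "degree R < degree A" "height_le R (2 * H\<^sup>2)"
    "\<And>x::complex. int_poly_at R x \<noteq> 0 \<or> int_poly_at B x \<noteq> 0"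
    "norm (int_poly_at R z) + norm (int_poly_at B z)
       \<le> 2 * H * (1 + norm z) ^ degree A * (norm (int_poly_at A z) + norm (int_poly_at B z))"
proof -
  define e where "e = degree A - degree B"
  define a where "a = lead_coeff A"
  define b where "b = lead_coeff B"
  define R where "R = smult b A + smult (- a) (monom 1 e * B)"
  have b0: "b \<noteq> 0" using \<open>B \<noteq> 0\<close> by (simp add: b_def)
  have aH: "\<bar>real_of_int a\<bar> \<le> H" "\<bar>real_of_int b\<bar> \<le> H"
    using assms(4,5) by (simp_all add: a_def b_def height_le_def)
  have RC: "coeff R i = b * coeff A i - a * (if e \<le> i then coeff B (i - e) else 0)" for i
    by (simp add: R_def coeff_monom_mult)
  have "degree R \<le> degree A"
  proof (rule degree_le, intro allI impI)
    fix i assume "degree A < i"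
    then show "coeff R i = 0"
      using deg by (simp add: RC e_def coeff_eq_0)
  qed
  moreover have "coeff R (degree A) = 0"
    using deg by (simp add: RC e_def a_def b_def)
  ultimately have "degree R < degree A"
    using deg(2) by (metis degree_0 le_neq_implies_less leading_coeff_0_iff)
  moreover have "height_le R (2 * H\<^sup>2)"
    unfolding height_le_def
  proof
    fix i
    let ?t = "if e \<le> i then coeff B (i - e) else 0"
    have t: "\<bar>real_of_int ?t\<bar> \<le> H"
      using assms(5,6) by (simp add: height_le_def)
    have "\<bar>real_of_int (coeff R i)\<bar> \<le> \<bar>real_of_int b * of_int (coeff A i)\<bar> + \<bar>real_of_int a * of_int ?t\<bar>"
      unfolding RC of_int_diff of_int_mult by linarith
    also have "\<dots> \<le> H * H + H * H"
      unfolding abs_mult using aH t height_leD[OF assms(4)] assms(6)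
      by (intro add_mono mult_mono) auto
    finally show "\<bar>real_of_int (coeff R i)\<bar> \<le> 2 * H\<^sup>2"
      by (simp add: power2_eq_square)
  qed
  moreover have at: "int_poly_at R x
      = of_int b * int_poly_at A x - of_int a * (x ^ e * int_poly_at B x)" for x :: complex
    unfolding R_def of_int_poly_add of_int_poly_smult of_int_poly_mult
    by (simp add: map_poly_monom poly_monom)
  have "int_poly_at R x \<noteq> 0 \<or> int_poly_at B x \<noteq> 0" for x :: complex
    using coprime[of x] b0 by (auto simp: at)
  moreover have "norm (int_poly_at R z) + norm (int_poly_at B z)
       \<le> 2 * H * (1 + norm z) ^ degree A * (norm (int_poly_at A z) + norm (int_poly_at B z))"
  proof -
    let ?A = "norm (int_poly_at A z)" and ?B = "norm (int_poly_at B z)"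
    let ?W = "(1 + norm z) ^ degree A"
    have W1: "?W \<ge> 1" by (rule one_le_power) simp
    have "norm z ^ e \<le> (1 + norm z) ^ e" by (rule power_mono) auto
    also have "\<dots> \<le> ?W" by (rule power_increasing) (auto simp: e_def)
    finally have zW: "norm z ^ e \<le> ?W" .
    have "norm (int_poly_at R z)
        \<le> \<bar>real_of_int b\<bar> * ?A + \<bar>real_of_int a\<bar> * (norm z ^ e * ?B)"
      unfolding at by (rule order_trans[OF norm_triangle_ineq4]) (simp add: norm_mult norm_power)
    also have "\<dots> \<le> (H * ?W) * ?A + H * (?W * ?B)"
    proof (intro add_mono mult_mono)
      have "\<bar>real_of_int b\<bar> * 1 \<le> H * ?W"
        using aH W1 assms(6) by (intro mult_mono) auto
      then show "\<bar>real_of_int b\<bar> \<le> H * ?W" by simp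
    qed (use aH zW assms(6) W1 in auto)
    finally have R: "norm (int_poly_at R z) \<le> H * ?W * (?A + ?B)" by (simp add: algebra_simps)
    have "1 * 1 \<le> H * ?W" using W1 assms(6) by (intro mult_mono) auto
    then have "1 * (?A + ?B) \<le> H * ?W * (?A + ?B)" by (intro mult_right_mono) auto
    then have "?B \<le> H * ?W * (?A + ?B)" using norm_ge_zero[of "int_poly_at A z"] unfolding mult_1 by linarith
    then show ?thesis using R by (simp add: mult.assoc)
  qed
  ultimately show ?thesis using that by blast
qed

text \<open>The Euclidean algorithm, run on \<open>A\<close> and \<open>B\<close> in steps of \<open>euclid_step\<close>, ends with a
  nonzero constant, which is an integer and so has absolute value at least 1. The number of steps is
  at most \<open>degree A + degree B\<close>, so the accumulated loss is a fixed power of the height. This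
  replaces the usual argument by resultants. If \<open>B\<close> vanishes before \<open>A\<close> is constant, then
  any complex root of \<open>A\<close> is a common root.\<close>

lemma coprime_int_polys_lower_bound:
  fixes z :: complex
  shows "\<exists>c k. c > 0 \<and> (\<forall>A B H. degree A + degree B \<le> m \<longrightarrow> height_le A H \<longrightarrow> height_le B H \<longrightarrow>
           H \<ge> 1 \<longrightarrow> (\<forall>x::complex. int_poly_at A x \<noteq> 0 \<or> int_poly_at B x \<noteq> 0) \<longrightarrow>
           c \<le> H ^ k * (norm (int_poly_at A z) + norm (int_poly_at B z)))"
proof (induction m)
  case 0
  show ?case
  proof (intro exI[of _ "1::real"] exI[of _ "0::nat"] conjI allI impI)
    fix A B :: "int poly" and H :: real
    assume "degree A + degree B \<le> 0"
      and nc: "\<forall>x::complex. int_poly_at A x \<noteq> 0 \<or> int_poly_at B x \<noteq> 0"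
    then have "degree A = 0" "degree B = 0" by auto
    moreover have "A \<noteq> 0 \<or> B \<noteq> 0" using nc by auto
    ultimately have "norm (int_poly_at A z) \<ge> 1 \<or> norm (int_poly_at B z) \<ge> 1"
      using norm_const_int_poly_at_ge_1 by blast
    then show "1 \<le> H ^ 0 * (norm (int_poly_at A z) + norm (int_poly_at B z))"
      using norm_ge_zero[of "int_poly_at A z"] norm_ge_zero[of "int_poly_at B z"]
      unfolding power_0 mult_1 by linarith
  qed simp
next
  case (Suc m)
  then obtain c k where c: "c > 0" and IH: "\<And>A B H. degree A + degree B \<le> m \<Longrightarrow> height_le A H \<Longrightarrow>
      height_le B H \<Longrightarrow> H \<ge> 1 \<Longrightarrow> (\<forall>x::complex. int_poly_at A x \<noteq> 0 \<or> int_poly_at B x \<noteq> 0) \<Longrightarrow>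
      c \<le> H ^ k * (norm (int_poly_at A z) + norm (int_poly_at B z))"
    by blast
  define W where "W = (1 + norm z) ^ Suc m"
  have W1: "W \<ge> 1" unfolding W_def by (rule one_le_power) simp
  define c' where "c' = min 1 (c / (2 ^ k * 2 * W))"
  have c': "c' > 0" using c W1 by (simp add: c'_def)
  have main: "c' \<le> H ^ (2 * k + 1) * (norm (int_poly_at A z) + norm (int_poly_at B z))"
    if d: "degree A + degree B \<le> Suc m" and h: "height_le A H" "height_le B H" "H \<ge> 1"
      and nc: "\<And>x::complex. int_poly_at A x \<noteq> 0 \<or> int_poly_at B x \<noteq> 0"
      and le: "degree B \<le> degree A"
    for A B H
  proof -
    let ?S = "norm (int_poly_at A z) + norm (int_poly_at B z)"
    have large: ?thesis if "?S \<ge> 1"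
    proof -
      have "H ^ (2 * k + 1) \<ge> 1" using h(3) one_le_power by blast
      then have "1 * 1 \<le> H ^ (2 * k + 1) * ?S" using that by (intro mult_mono) auto
      then show ?thesis by (simp add: c'_def)
    qed
    consider "degree A = 0" | "degree A > 0" "B \<noteq> 0" | "degree A > 0" "B = 0" by blast
    then show ?thesis
    proof cases
      case 1
      then have "degree B = 0" using le by simp
      have "A \<noteq> 0 \<or> B \<noteq> 0" using nc by auto
      then have "norm (int_poly_at A z) \<ge> 1 \<or> norm (int_poly_at B z) \<ge> 1"
        using norm_const_int_poly_at_ge_1 1 \<open>degree B = 0\<close> by blast
      then show ?thesis
        using norm_ge_zero[of "int_poly_at A z"] norm_ge_zero[of "int_poly_at B z"]
        by (intro large) linarith
    next
      case 2
      from euclid_step[OF le 2 h nc, of z]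
      obtain R where R: "degree R < degree A" "height_le R (2 * H\<^sup>2)"
        "\<And>x::complex. int_poly_at R x \<noteq> 0 \<or> int_poly_at B x \<noteq> 0"
        "norm (int_poly_at R z) + norm (int_poly_at B z) \<le> 2 * H * (1 + norm z) ^ degree A * ?S"
        by blast
      (* B keeps its height H, and is fed to the induction hypothesis with the larger bound. *)
      have HH: "H \<le> 2 * H\<^sup>2"
        using h(3) mult_mono[of 1 H H H] by (simp add: power2_eq_square)
      have "c \<le> (2 * H\<^sup>2) ^ k * (norm (int_poly_at R z) + norm (int_poly_at B z))"
        using R d HH h by (intro IH) (auto intro: height_le_mono)
      also have "\<dots> \<le> (2 * H\<^sup>2) ^ k * (2 * H * (1 + norm z) ^ degree A * ?S)"
        using R(4) h by (intro mult_left_mono) auto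
      also have "\<dots> \<le> (2 * H\<^sup>2) ^ k * (2 * H * W * ?S)"
        unfolding W_def using d h
        by (intro mult_left_mono mult_right_mono power_increasing) auto
      also have "\<dots> = (2 ^ k * 2 * W) * (H ^ (2 * k + 1) * ?S)"
        by (simp add: power_mult_distrib mult_ac flip: power_mult)
      finally have "c / (2 ^ k * 2 * W) \<le> H ^ (2 * k + 1) * ?S"
        using W1 by (simp add: divide_le_eq mult_ac)
      then show ?thesis by (simp add: c'_def)
    next
      case 3
      have "\<not> constant (poly (map_poly of_int A :: complex poly))"
        using 3 by (simp add: constant_degree degree_map_poly)
      then obtain x :: complex where "int_poly_at A x = 0"
        using fundamental_theorem_of_algebra by blast
      then show ?thesis using nc[of x] 3 by simp
    qed
  qed
  show ?case
  proof (intro exI[of _ c'] exI[of _ "2 * k + 1"] conjI allI impI c')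
    fix A B :: "int poly" and H :: real
    assume "degree A + degree B \<le> Suc m" "height_le A H" "height_le B H" "H \<ge> 1"
      and "\<forall>x::complex. int_poly_at A x \<noteq> 0 \<or> int_poly_at B x \<noteq> 0"
    then show "c' \<le> H ^ (2 * k + 1) * (norm (int_poly_at A z) + norm (int_poly_at B z))"
      using main[of A B H] main[of B A H] by (cases "degree B \<le> degree A") (auto simp: add.commute)
  qed
qed

text \<open>An irreducible \<open>p\<close> shares no complex root with a nonzero polynomial of smaller degree, and
  \<open>p\<close> itself contributes nothing to the lower bound at its root \<open>z\<close>.\<close>

lemma int_poly_at_root_lower_bound:
  fixes z :: complex
  assumes p: "irreducible p" "int_poly_at p z = 0"
  shows "\<exists>c k. c > 0 \<and> (\<forall>G H. G \<noteq> 0 \<longrightarrow> degree G < degree p \<longrightarrow> height_le G H \<longrightarrow> H \<ge> 1 \<longrightarrow>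
           c \<le> H ^ k * norm (int_poly_at G z))"
proof -
  define h where "h = 1 + (\<Sum>i\<le>degree p. \<bar>real_of_int (coeff p i)\<bar>)"
  have h1: "h \<ge> 1" unfolding h_def by (simp add: sum_nonneg)
  have hp: "height_le p h"
    unfolding height_le_def
  proof
    fix i
    show "\<bar>real_of_int (coeff p i)\<bar> \<le> h"
    proof (cases "i \<le> degree p")
      case True
      then have "\<bar>real_of_int (coeff p i)\<bar> \<le> (\<Sum>i\<le>degree p. \<bar>real_of_int (coeff p i)\<bar>)"
        by (intro member_le_sum) auto
      then show ?thesis by (simp add: h_def)
    next
      case False
      then show ?thesis using h1 by (simp add: coeff_eq_0)
    qed
  qed
  obtain c k where c: "c > 0" and bound: "\<And>A B H. degree A + degree B \<le> 2 * degree p \<Longrightarrow>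
      height_le A H \<Longrightarrow> height_le B H \<Longrightarrow> H \<ge> 1 \<Longrightarrow>
      (\<forall>x::complex. int_poly_at A x \<noteq> 0 \<or> int_poly_at B x \<noteq> 0) \<Longrightarrow>
      c \<le> H ^ k * (norm (int_poly_at A z) + norm (int_poly_at B z))"
    using coprime_int_polys_lower_bound[of "2 * degree p" z] by blast
  show ?thesis
  proof (intro exI[of _ "c / h ^ k"] exI[of _ k] conjI allI impI)
    show "c / h ^ k > 0" using c h1 by simp
    fix G :: "int poly" and H :: real
    assume G: "G \<noteq> 0" "degree G < degree p" "height_le G H" "H \<ge> 1"
    have hH: "H \<le> h * H" "h \<le> h * H"
      using mult_right_mono[of 1 h H] mult_left_mono[of 1 H h] G h1 by auto
    have "c \<le> (h * H) ^ k * (norm (int_poly_at p z) + norm (int_poly_at G z))"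
    proof (rule bound)
      show "h * H \<ge> 1" using hH h1 by linarith
      show "\<forall>x::complex. int_poly_at p x \<noteq> 0 \<or> int_poly_at G x \<noteq> 0"
        using irreducible_degree_le[OF p(1)] G by (meson not_le)
    qed (use G hp hH h1 in \<open>auto intro: height_le_mono\<close>)
    then show "c / h ^ k \<le> H ^ k * norm (int_poly_at G z)"
      using p(2) h1 by (simp add: power_mult_distrib divide_le_eq mult_ac)
  qed
qed

section \<open>Extracting the component of a sequence along a root\<close>

text \<open>For a root \<open>z\<close> of \<open>p\<close>, the numbers \<open>horner_tail p z (Suc j)\<close> are the coefficients of
  the quotient \<open>p(x) / (x - z)\<close>, as produced by Horner's scheme.\<close>

definition horner_tail :: "int poly \<Rightarrow> complex \<Rightarrow> nat \<Rightarrow> complex" where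
  "horner_tail p z j = int_poly_at (poly_shift j p) z"

text \<open>This is the operator \<open>p(S) / (S - z)\<close> applied to \<open>w\<close>, where \<open>S\<close> is the shift of sequences.
  On solutions of the recurrence of \<open>p\<close>, its values are multiples of \<open>z ^ n\<close>.\<close>

definition eigen_part :: "int poly \<Rightarrow> complex \<Rightarrow> (nat \<Rightarrow> complex) \<Rightarrow> nat \<Rightarrow> complex" where
  "eigen_part p z w n = (\<Sum>j<degree p. horner_tail p z (Suc j) * w (n + j))"

lemma horner_tail_step:
  "horner_tail p z j = of_int (coeff p j) + z * horner_tail p z (Suc j)"
proof -
  have "poly_shift j p = pCons (coeff p j) (poly_shift (Suc j) p)"
    by (rule poly_eqI) (auto simp: coeff_pCons coeff_poly_shift split: nat.splits)
  then show ?thesis by (simp add: horner_tail_def map_poly_pCons)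
qed

lemma horner_tail_0: "horner_tail p z 0 = int_poly_at p z"
proof -
  have "poly_shift 0 p = p" by (rule poly_eqI) (simp add: coeff_poly_shift)
  then show ?thesis by (simp add: horner_tail_def)
qed

lemma horner_tail_beyond_degree: "horner_tail p z (Suc (degree p)) = 0"
proof -
  have "poly_shift (Suc (degree p)) p = 0"
    by (rule poly_eqI) (simp add: coeff_poly_shift coeff_eq_0)
  then show ?thesis by (simp add: horner_tail_def)
qed

text \<open>This is the operator identity \<open>(S - z) * (p(S) / (S - z)) = p(S)\<close>.\<close>

lemma eigen_part_Suc:
  assumes "int_poly_at p z = 0"
  shows "eigen_part p z w (Suc n)
    = z * eigen_part p z w n + (\<Sum>j<Suc (degree p). of_int (coeff p j) * w (n + j))"
proof -
  let ?s = "horner_tail p z"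
  have "eigen_part p z w (Suc n) = (\<Sum>j<Suc (degree p). ?s j * w (n + j))"
    by (subst sum.lessThan_Suc_shift) (simp add: eigen_part_def horner_tail_0 assms)
  also have "\<dots> = (\<Sum>j<Suc (degree p). z * (?s (Suc j) * w (n + j))
                       + of_int (coeff p j) * w (n + j))"
    by (intro sum.cong refl, subst horner_tail_step) (simp add: algebra_simps)
  also have "\<dots> = z * (\<Sum>j<Suc (degree p). ?s (Suc j) * w (n + j))
                   + (\<Sum>j<Suc (degree p). of_int (coeff p j) * w (n + j))"
    by (simp only: sum.distrib sum_distrib_left)
  also have "(\<Sum>j<Suc (degree p). ?s (Suc j) * w (n + j)) = eigen_part p z w n"
    by (simp add: eigen_part_def horner_tail_beyond_degree)
  finally show ?thesis .
qed

text \<open>The geometric sequence \<open>x ^ n\<close> solves the recurrence of \<open>p\<close>, so one step multiplies its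
  \<open>z\<close>-component by \<open>z\<close>; by homogeneity one step also multiplies it by \<open>x\<close>.\<close>

lemma eigen_part_other_root:
  fixes x z :: complex
  assumes "int_poly_at p z = 0" "int_poly_at p x = 0" "x \<noteq> z"
  shows "eigen_part p z (\<lambda>n. x ^ n) n = 0"
proof -
  let ?v = "eigen_part p z (\<lambda>n. x ^ n)"
  have "?v (Suc n) = x * ?v n"
    by (simp add: eigen_part_def sum_distrib_left mult_ac)
  moreover have "(\<Sum>j<Suc (degree p). of_int (coeff p j) * x ^ (n + j)) = x ^ n * int_poly_at p x"
    unfolding int_poly_at_altdef[OF order_refl] sum_distrib_left
    by (intro sum.cong refl) (simp add: power_add mult_ac)
  ultimately have "x * ?v n = z * ?v n"
    using eigen_part_Suc[OF assms(1), of "\<lambda>n. x ^ n" n] assms(2)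
    by (metis add.right_neutral mult_zero_right)
  then show ?thesis using assms(3) by (metis mult_right_cancel)
qed

lemma eigen_part_linear:
  "eigen_part p z (\<lambda>n. c * f n - g n) n = c * eigen_part p z f n - eigen_part p z g n"
  by (simp add: eigen_part_def sum_distrib_left sum_subtractf algebra_simps)

text \<open>The component at position \<open>n\<close> is the value at \<open>z\<close> of the integer polynomial
  \<open>G = \<Sum>j<d. u (n + j) * (a\<^sub>j\<^sub>+\<^sub>1 + a\<^sub>j\<^sub>+\<^sub>2 x + \<dots> + a\<^sub>d x ^ (d - 1 - j))\<close>.
  Only \<open>u n\<close> contributes to its coefficient at \<open>x ^ (d - 1)\<close>, so \<open>u n \<noteq> 0\<close> suffices for
  \<open>G \<noteq> 0\<close> and the Liouville inequality applies.\<close>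

lemma eigen_part_of_int_lower_bound:
  fixes z :: complex
  assumes p: "irreducible p" "int_poly_at p z = 0"
  shows "\<exists>c k. c > 0 \<and> (\<forall>u n M. u n \<noteq> (0::int) \<longrightarrow> M \<ge> 1 \<longrightarrow>
           (\<forall>j<degree p. \<bar>real_of_int (u (n + j))\<bar> \<le> M) \<longrightarrow>
           c \<le> M ^ k * norm (eigen_part p z (\<lambda>n. of_int (u n)) n))"
proof -
  obtain c k where c: "c > 0" and bound: "\<And>G H. G \<noteq> 0 \<Longrightarrow> degree G < degree p \<Longrightarrow>
      height_le G H \<Longrightarrow> H \<ge> 1 \<Longrightarrow> c \<le> H ^ k * norm (int_poly_at G z)"
    using int_poly_at_root_lower_bound[OF p] by blast
  define L where "L = (\<Sum>j<Suc (degree p). \<bar>real_of_int (coeff p j)\<bar>)"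
  have p0: "p \<noteq> 0" using p(1) by auto
  have deg: "degree p > 0" using degree_pos_of_root[OF p0 p(2)] .
  have aL: "\<bar>real_of_int (coeff p i)\<bar> \<le> L" for i
  proof (cases "i < Suc (degree p)")
    case True
    then show ?thesis unfolding L_def by (intro member_le_sum) auto
  next
    case False
    then show ?thesis by (simp add: L_def coeff_eq_0 sum_nonneg)
  qed
  have "\<bar>lead_coeff p\<bar> \<ge> 1" using p0 by (metis leading_coeff_0_iff zero_less_abs_iff zless_imp_add1_zle add_0)
  then have L1: "L \<ge> 1" using aL[of "degree p"] by linarith
  define K where "K = real (degree p) * L"
  have K1: "K \<ge> 1" using mult_mono[of 1 "real (degree p)" 1 L] L1 deg by (simp add: K_def)
  show ?thesis
  proof (intro exI[of _ "c / K ^ k"] exI[of _ k] conjI allI impI)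
    show "c / K ^ k > 0" using c K1 by simp
    fix u :: "nat \<Rightarrow> int" and n and M :: real
    assume u0: "u n \<noteq> 0" and M: "M \<ge> 1" "\<forall>j<degree p. \<bar>real_of_int (u (n + j))\<bar> \<le> M"
    define G where "G = (\<Sum>j<degree p. smult (u (n + j)) (poly_shift (Suc j) p))"
    have GC: "coeff G i = (\<Sum>j<degree p. u (n + j) * coeff p (Suc j + i))" for i
      by (simp add: G_def coeff_sum coeff_poly_shift add.commute)
    have "degree G \<le> degree p - 1"
      by (rule degree_le) (auto simp: GC coeff_eq_0 intro!: sum.neutral)
    moreover have "coeff G (degree p - 1) = u n * lead_coeff p"
    proof -
      have "coeff G (degree p - 1) = (\<Sum>j\<in>{0}. u (n + j) * coeff p (Suc j + (degree p - 1)))"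
        unfolding GC using deg by (intro sum.mono_neutral_right) (auto simp: coeff_eq_0)
      then show ?thesis using deg by simp
    qed
    then have "G \<noteq> 0" using u0 p0 by auto
    moreover have "height_le G (K * M)"
      unfolding height_le_def
    proof
      fix i
      have "\<bar>real_of_int (coeff G i)\<bar> \<le> (\<Sum>j<degree p. \<bar>real_of_int (u (n + j) * coeff p (Suc j + i))\<bar>)"
        unfolding GC of_int_sum by (rule sum_abs)
      also have "\<dots> \<le> (\<Sum>j<degree p. M * L)"
        using M aL unfolding of_int_mult abs_mult by (intro sum_mono mult_mono) auto
      finally show "\<bar>real_of_int (coeff G i)\<bar> \<le> K * M" by (simp add: K_def mult_ac)
    qed
    moreover have "K * M \<ge> 1" using mult_mono[of 1 K 1 M] K1 M by simp
    ultimately have "c \<le> (K * M) ^ k * norm (int_poly_at G z)"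
      using deg by (intro bound) auto
    moreover have "int_poly_at G z = eigen_part p z (\<lambda>n. of_int (u n)) n"
    proof -
      have "map_poly of_int G = (\<Sum>j<degree p. smult (of_int (u (n + j))) (map_poly of_int (poly_shift (Suc j) p)) :: complex poly)"
        by (rule poly_eqI) (simp add: GC coeff_map_poly coeff_sum coeff_poly_shift add.commute)
      then show ?thesis
        by (simp add: eigen_part_def horner_tail_def poly_sum mult.commute)
    qed
    ultimately show "c / K ^ k \<le> M ^ k * norm (eigen_part p z (\<lambda>n. of_int (u n)) n)"
      using K1 by (simp add: power_mult_distrib divide_le_eq mult_ac)
  qed
qed

section \<open>Indices far from the integers\<close>

text \<open>The recurrence sum of the integers differs from \<open>s\<close> by at most the weighted rounding errors,
  so it is an integer of absolute value less than 1.\<close>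

lemma integer_recurrence_if_close:
  fixes x :: "nat \<Rightarrow> real" and u :: "nat \<Rightarrow> int"
  assumes lin: "(\<Sum>j<Suc d. of_int (a j) * x j) = s"
    and close: "\<And>j. j < Suc d \<Longrightarrow> \<bar>x j - of_int (u j)\<bar> \<le> \<delta>"
    and small: "(\<Sum>j<Suc d. \<bar>real_of_int (a j)\<bar>) * \<delta> + \<bar>s\<bar> < 1"
  shows "(\<Sum>j<Suc d. a j * u j) = 0"
proof -
  have "real_of_int (\<Sum>j<Suc d. a j * u j) = s - (\<Sum>j<Suc d. of_int (a j) * (x j - of_int (u j)))"
    unfolding lin[symmetric] by (simp only: of_int_sum of_int_mult right_diff_distrib sum_subtractf)
  moreover have "\<bar>\<Sum>j<Suc d. of_int (a j) * (x j - of_int (u j))\<bar>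
      \<le> (\<Sum>j<Suc d. \<bar>real_of_int (a j)\<bar>) * \<delta>"
    unfolding sum_distrib_right using close
    by (intro order_trans[OF sum_abs] sum_mono) (auto simp: abs_mult intro!: mult_left_mono)
  ultimately have "\<bar>real_of_int (\<Sum>j<Suc d. a j * u j)\<bar> < 1" using small by linarith
  then show ?thesis by linarith
qed

text \<open>If all indices in the window \<open>{m..D * m}\<close> were near an integer, the \<open>\<beta>\<close>-component of the
  nearest integers would be multiplied by \<open>\<beta>\<close> throughout the window. It starts no smaller than a
  constant times \<open>\<alpha> ^ (- k * m)\<close> and its norm never exceeds \<open>2 * B\<close>, which is impossible when \<open>D\<close> is
  large. That \<open>D\<close> depends on \<open>\<xi>\<close> only through \<open>X\<close>, and not on \<open>\<eta>\<close>, \<open>\<delta>\<close> or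
  \<open>m\<close>, is what makes the constants in the theorem uniform. The bound \<open>3/2\<close> forces \<open>u m \<noteq> 0\<close>, as \<open>\<bar>\<eta>\<bar> \<le> 1\<close> and
  the rounding error is at most \<open>1/2\<close>.\<close>

lemma far_index_in_window:
  fixes \<alpha> X :: real and \<beta> :: complex and p :: "int poly"
  assumes p: "irreducible p" "int_poly_at p \<alpha> = 0" "int_poly_at p \<beta> = 0"
    and \<alpha>: "\<alpha> > 1" and \<beta>: "\<beta> \<noteq> of_real \<alpha>" "norm \<beta> > 1" and X: "X \<ge> 0"
  shows "\<exists>D::nat. D \<ge> 1 \<and> (\<forall>\<xi> \<eta> \<delta> m. \<bar>\<xi>\<bar> \<le> X \<longrightarrow> \<bar>\<eta>\<bar> \<le> 1 \<longrightarrow> m \<ge> 1 \<longrightarrow> \<bar>\<xi>\<bar> * \<alpha> ^ m > 3/2 \<longrightarrow>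
      (\<Sum>j<Suc (degree p). \<bar>real_of_int (coeff p j)\<bar>) * \<delta>
        + \<bar>\<eta> * (\<Sum>j<Suc (degree p). real_of_int (coeff p j))\<bar> < 1 \<longrightarrow>
      (\<exists>n\<in>{m..D * m}. dist_int (\<xi> * \<alpha> ^ n - \<eta>) \<ge> \<delta>))"
proof -
  let ?d = "degree p"
  let ?v = "eigen_part p \<beta>"
  obtain c k where c: "c > 0" and bound: "\<And>u n M. u n \<noteq> (0::int) \<Longrightarrow> M \<ge> 1 \<Longrightarrow>
           (\<forall>j<?d. \<bar>real_of_int (u (n + j))\<bar> \<le> M) \<Longrightarrow>
           c \<le> M ^ k * norm (?v (\<lambda>n. of_int (u n)) n)"
    using eigen_part_of_int_lower_bound[OF p(1,3)] by blast
  define B where "B = (\<Sum>j<?d. norm (horner_tail p \<beta> (Suc j)))"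
  have B0: "B \<ge> 0" by (simp add: B_def sum_nonneg)
  define K where "K = (X + 2) * \<alpha> ^ ?d"
  have K1: "K \<ge> 1"
    using mult_mono[of 1 "X + 2" 1 "\<alpha> ^ ?d"] X \<alpha> by (simp add: K_def)
  define T where "T = max 1 (K ^ k * (2 * B) / c)"
  (* E steps per unit of m outweigh the Liouville loss \<alpha> ^ k per unit of m; as m \<ge> 1, the factor T
     absorbs the constants. *)
  obtain E where E: "\<alpha> ^ k * T < norm \<beta> ^ E" using real_arch_pow[OF \<beta>(2)] by blast
  show ?thesis
  (* E * m steps of growth, starting at m, read u at most ?d places further on. *)
  proof (intro exI[of _ "E + ?d + 1"] conjI allI impI)
    fix \<xi> \<eta> \<delta> :: real and m :: nat
    assume \<xi>: "\<bar>\<xi>\<bar> \<le> X" and \<eta>: "\<bar>\<eta>\<bar> \<le> 1" and m: "m \<ge> 1" and big: "\<bar>\<xi>\<bar> * \<alpha> ^ m > 3/2"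
      and small: "(\<Sum>j<Suc (degree p). \<bar>real_of_int (coeff p j)\<bar>) * \<delta>
        + \<bar>\<eta> * (\<Sum>j<Suc (degree p). real_of_int (coeff p j))\<bar> < 1"
    define u where "u n = round (\<xi> * \<alpha> ^ n - \<eta>)" for n
    have err: "\<bar>\<xi> * \<alpha> ^ n - \<eta> - of_int (u n)\<bar> \<le> 1/2" for n
      using of_int_round_abs_le[of "\<xi> * \<alpha> ^ n - \<eta>"] by (simp add: u_def abs_minus_commute)
    let ?V = "?v (\<lambda>n. of_int (u n))"
    (* The bound on the component holds at every index, near or far: the multiple of \<alpha> ^ n is killed,
       and the sequence that remains is bounded by \<bar>\<eta>\<bar> + 1/2 \<le> 2. *)
    have V_le: "norm (?V n) \<le> 2 * B" for n
    proof -
      define e where "e n = \<xi> * \<alpha> ^ n - of_int (u n)" for n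
      have e: "\<bar>e n\<bar> \<le> 2" for n using err[of n] \<eta> unfolding e_def by linarith
      have "int_poly_at p (complex_of_real \<alpha>) = of_real (int_poly_at p \<alpha>)"
        unfolding int_poly_at_altdef[OF order_refl] by simp
      then have "int_poly_at p (complex_of_real \<alpha>) = 0" using p(2) by simp
      then have "?v (\<lambda>n. of_real \<alpha> ^ n) n = 0"
        using eigen_part_other_root[OF p(3)] \<beta>(1) by blast
      moreover have "(\<lambda>n. of_int (u n)) = (\<lambda>n. complex_of_real \<xi> * of_real \<alpha> ^ n - of_real (e n))"
        by (simp add: e_def)
      ultimately have "?V n = - ?v (\<lambda>n. of_real (e n)) n"
        by (simp only: eigen_part_linear) simp
      then have "norm (?V n) \<le> (\<Sum>j<?d. norm (horner_tail p \<beta> (Suc j) * complex_of_real (e (n + j))))"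
        by (simp add: eigen_part_def norm_sum)
      also have "\<dots> \<le> (\<Sum>j<?d. norm (horner_tail p \<beta> (Suc j)) * 2)"
        using e by (intro sum_mono) (auto simp: norm_mult intro!: mult_left_mono)
      finally show ?thesis by (simp add: B_def sum_distrib_left mult.commute)
    qed
    have u0: "u m \<noteq> 0"
    proof
      assume "u m = 0"
      then have "\<bar>\<xi> * \<alpha> ^ m - \<eta>\<bar> \<le> 1/2" using err[of m] by simp
      then have "\<bar>\<xi> * \<alpha> ^ m\<bar> \<le> 3/2" using \<eta> by linarith
      then show False using big \<alpha> by (simp add: abs_mult)
    qed
    have uM: "\<bar>real_of_int (u (m + j))\<bar> \<le> K * \<alpha> ^ m" if "j < ?d" for j
    proof -
      have 1: "\<alpha> ^ (m + j) \<ge> 1" using \<alpha> by simp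
      have "\<bar>real_of_int (u (m + j))\<bar> \<le> \<bar>\<xi> * \<alpha> ^ (m + j)\<bar> + 2"
        using err[of "m + j"] \<eta> by linarith
      also have "\<dots> \<le> X * \<alpha> ^ (m + j) + 2 * \<alpha> ^ (m + j)"
        using \<xi> \<alpha> 1 by (intro add_mono) (auto simp: abs_mult intro!: mult_right_mono)
      also have "\<dots> = (X + 2) * \<alpha> ^ (m + j)" by (simp add: algebra_simps)
      also have "\<dots> \<le> (X + 2) * \<alpha> ^ (m + ?d)"
        using that \<alpha> X by (intro mult_left_mono power_increasing) auto
      finally show ?thesis by (simp add: K_def power_add mult_ac)
    qed
    have "1 \<le> K * \<alpha> ^ m"
      using mult_mono[of 1 K 1 "\<alpha> ^ m"] K1 \<alpha> by simp
    then have low: "c \<le> (K * \<alpha> ^ m) ^ k * norm (?V m)"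
      using bound[of u m "K * \<alpha> ^ m"] u0 uM by blast
    show "\<exists>n\<in>{m..(E + ?d + 1) * m}. dist_int (\<xi> * \<alpha> ^ n - \<eta>) \<ge> \<delta>"
    proof (rule ccontr)
      assume near: "\<not> ?thesis"
      have good: "\<bar>\<xi> * \<alpha> ^ n - \<eta> - of_int (u n)\<bar> \<le> \<delta>" if "m \<le> n" "n \<le> (E + ?d + 1) * m" for n
      proof -
        have "dist_int (\<xi> * \<alpha> ^ n - \<eta>) < \<delta>"
          using near that by (meson atLeastAtMost_iff not_le)
        then show ?thesis by (simp add: dist_int_def u_def)
      qed
      have rec: "?V (Suc n) = \<beta> * ?V n" if n: "m \<le> n" "n + ?d \<le> (E + ?d + 1) * m" for n
      proof -
        have "(\<Sum>j<Suc ?d. of_int (coeff p j) * (\<xi> * \<alpha> ^ (n + j) - \<eta>))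
            = \<xi> * \<alpha> ^ n * int_poly_at p \<alpha> - \<eta> * (\<Sum>j<Suc ?d. of_int (coeff p j))"
          unfolding int_poly_at_altdef[OF order_refl] sum_distrib_left sum_subtractf[symmetric]
          by (intro sum.cong refl) (simp add: power_add algebra_simps)
        also have "\<dots> = - (\<eta> * (\<Sum>j<Suc ?d. of_int (coeff p j)))"
          using p(2) by simp
        finally have lin: "(\<Sum>j<Suc ?d. of_int (coeff p j) * (\<xi> * \<alpha> ^ (n + j) - \<eta>))
            = - (\<eta> * (\<Sum>j<Suc ?d. of_int (coeff p j)))" .
        have small': "(\<Sum>j<Suc ?d. \<bar>real_of_int (coeff p j)\<bar>) * \<delta>
            + \<bar>- (\<eta> * (\<Sum>j<Suc ?d. real_of_int (coeff p j)))\<bar> < 1"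
          using small by (simp only: abs_minus_cancel)
        have "(\<Sum>j<Suc ?d. coeff p j * u (n + j)) = 0"
          by (rule integer_recurrence_if_close[OF lin _ small'], rule good) (use n in auto)
        then have "(\<Sum>j<Suc ?d. of_int (coeff p j) * complex_of_int (u (n + j))) = 0"
          by (metis (no_types, lifting) of_int_0 of_int_mult of_int_sum sum.cong)
        then show ?thesis by (simp only: eigen_part_Suc[OF p(3)]) simp
      qed
      have grow: "?V (m + r) = \<beta> ^ r * ?V m" if "r \<le> E * m" for r
        using that
      proof (induction r)
        case (Suc r)
        have "r \<le> E * m" using Suc by simp
        moreover have "?d * 1 \<le> ?d * m" using m by (rule mult_le_mono2)
        ultimately have "m + r + ?d \<le> (E + ?d + 1) * m"
          unfolding distrib_right mult_1 mult_1_right by linarith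
        then show ?case using Suc rec[of "m + r"] by simp
      qed simp
      have "c * (\<alpha> ^ k * T) ^ m < c * (norm \<beta> ^ E) ^ m"
        using E c \<alpha> m by (intro mult_strict_left_mono power_strict_mono) (auto simp: T_def)
      also have "\<dots> \<le> (K * \<alpha> ^ m) ^ k * norm (?V m) * (norm \<beta> ^ E) ^ m"
        using low by (intro mult_right_mono) auto
      also have "\<dots> = (K * \<alpha> ^ m) ^ k * norm (?V (m + E * m))"
        by (simp add: grow norm_mult norm_power power_mult)
      also have "\<dots> \<le> (K * \<alpha> ^ m) ^ k * (2 * B)"
        using V_le K1 \<alpha> by (intro mult_left_mono) auto
      also have "\<dots> = (\<alpha> ^ k) ^ m * (K ^ k * (2 * B))"
        by (simp add: power_mult_distrib mult_ac flip: power_mult)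
      finally have "(\<alpha> ^ k) ^ m * (c * T ^ m) < (\<alpha> ^ k) ^ m * (K ^ k * (2 * B))"
        by (simp add: power_mult_distrib mult_ac)
      then have "c * T ^ m < K ^ k * (2 * B)" using \<alpha> by simp
      moreover have "K ^ k * (2 * B) \<le> c * T"
        using c by (simp add: T_def max_def divide_le_eq mult_ac split: if_splits)
      moreover have "T ^ 1 \<le> T ^ m" using m by (intro power_increasing) (auto simp: T_def)
      then have "c * T \<le> c * T ^ m" using c by simp
      ultimately show False by linarith
    qed
  qed simp
qed

text \<open>The blocks \<open>{D ^ i..<D ^ Suc i}\<close> are disjoint, and those with \<open>i < k\<close> lie below
  \<open>D ^ k \<le> N\<close> for \<open>k = \<lfloor>ln N / ln D\<rfloor>\<close>.\<close>

lemma card_ge_floor_log_if_meets_blocks: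
  fixes D N :: nat
  assumes D: "D \<ge> 2" and N: "N \<ge> 1"
    and blocks: "\<And>i. \<exists>n. D ^ i \<le> n \<and> n < D ^ Suc i \<and> P n"
  shows "int (card {n. 1 \<le> n \<and> n \<le> N \<and> P n}) \<ge> \<lfloor>1 / ln (real D) * ln (real N)\<rfloor>"
proof -
  define k where "k = nat \<lfloor>1 / ln (real D) * ln (real N)\<rfloor>"
  have lnD: "ln (real D) > 0" using D by simp
  have nonneg: "1 / ln (real D) * ln (real N) \<ge> 0" using lnD N by simp
  have "real k \<le> 1 / ln (real D) * ln (real N)"
    unfolding k_def using nonneg by (simp add: of_nat_nat)
  then have "real k * ln (real D) \<le> ln (real N)" using lnD by (simp add: field_simps)
  then have "ln (real (D ^ k)) \<le> ln (real N)" using D by (simp add: ln_realpow)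
  then have DkN: "D ^ k \<le> N" using D N by (simp del: of_nat_power)
  obtain f where f: "\<And>i. D ^ i \<le> f i" "\<And>i. f i < D ^ Suc i" "\<And>i. P (f i)"
    using blocks by metis
  have less: "f i < f j" if "i < j" for i j
  proof -
    have "f i < D ^ Suc i" by (rule f)
    also have "\<dots> \<le> D ^ j" using that D by (intro power_increasing) auto
    also have "\<dots> \<le> f j" by (rule f)
    finally show ?thesis .
  qed
  then have inj: "inj_on f {..<k}" by (intro inj_onI) (metis less_irrefl nat_neq_iff)
  have sub: "f ` {..<k} \<subseteq> {n. 1 \<le> n \<and> n \<le> N \<and> P n}"
  proof clarify
    fix i assume "i < k"
    have "1 \<le> D ^ i" using D by simp
    then have "1 \<le> f i" using f(1)[of i] by linarith
    moreover have "D ^ Suc i \<le> D ^ k" using \<open>i < k\<close> D by (intro power_increasing) auto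
    then have "f i \<le> N" using f(2)[of i] DkN by linarith
    ultimately show "1 \<le> f i \<and> f i \<le> N \<and> P (f i)" using f(3) by blast
  qed
  have "k = card (f ` {..<k})" using inj by (simp add: card_image)
  also have "\<dots> \<le> card {n. 1 \<le> n \<and> n \<le> N \<and> P n}"
    by (rule card_mono[OF _ sub]) simp
  finally show ?thesis unfolding k_def by linarith
qed

section \<open>The threshold and the count\<close>

lemma L_tilde_eq:
  "L_tilde \<alpha> = \<bar>\<Sum>j<Suc (degree (min_int_poly \<alpha>)). real_of_int (coeff (min_int_poly \<alpha>) j)\<bar>"
  by (simp add: L_tilde_def Let_def atLeast0AtMost lessThan_Suc_atMost)

text \<open>The value at 1 is an integer, and it is nonzero since otherwise the minimal polynomial would be
  \<open>x - 1\<close>. The consequence used later is that \<open>L_tilde \<alpha> * \<bar>\<eta>\<bar> < 1\<close> implies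
  \<open>\<bar>\<eta>\<bar> < 1\<close>, a bound that is uniform in \<open>\<eta>\<close>.\<close>

lemma L_tilde_ge_1:
  assumes "algebraic \<alpha>" "\<alpha> \<noteq> 1"
  shows "L_tilde \<alpha> \<ge> 1"
proof -
  let ?p = "min_int_poly \<alpha>"
  note p = min_int_poly[OF assms(1)]
  have at1: "real_of_int (\<Sum>j<Suc (degree ?p). coeff ?p j) = int_poly_at ?p 1"
    by (simp add: int_poly_at_altdef[OF order_refl])
  have "(\<Sum>j<Suc (degree ?p). coeff ?p j) \<noteq> 0"
  proof
    assume "(\<Sum>j<Suc (degree ?p). coeff ?p j) = 0"
    then have 1: "int_poly_at ?p (1::real) = 0" using at1 by simp
    have "?p = [:-1, 1:]"
    proof (rule irreducible_int_poly_unique[OF p(1,2) 1])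
      show "irreducible [:-1, 1 :: int:]"
        by (rule irreducible_linear_poly) simp_all
    qed (auto simp: map_poly_pCons)
    then show False using p(3) assms(2) by (simp add: map_poly_pCons)
  qed
  then have "\<bar>\<Sum>j<Suc (degree ?p). coeff ?p j\<bar> \<ge> 1" by linarith
  then show ?thesis unfolding L_tilde_eq by (simp only: of_int_sum[symmetric] of_int_abs[symmetric] of_int_1_le_iff)
qed

text \<open>Rounding errors below this value contribute at most half of the gap
  \<open>1 - L_tilde \<alpha> * \<bar>\<eta>\<bar>\<close> to the recurrence sum; adding 1 to the sum of the coefficients brings
  the value below \<open>1/2\<close>.\<close>

definition threshold :: "real \<Rightarrow> real \<Rightarrow> real" where
  "threshold \<alpha> \<eta> = (1 - L_tilde \<alpha> * \<bar>\<eta>\<bar>)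
     / (2 * (1 + (\<Sum>j<Suc (degree (min_int_poly \<alpha>)). \<bar>real_of_int (coeff (min_int_poly \<alpha>) j)\<bar>)))"

lemma threshold_bounds:
  assumes "algebraic \<alpha>" "\<alpha> \<noteq> 1" "L_tilde \<alpha> * \<bar>\<eta>\<bar> < 1"
  defines "L \<equiv> \<Sum>j<Suc (degree (min_int_poly \<alpha>)). \<bar>real_of_int (coeff (min_int_poly \<alpha>) j)\<bar>"
  shows "threshold \<alpha> \<eta> > 0" "threshold \<alpha> \<eta> < 1/2" "L * threshold \<alpha> \<eta> + L_tilde \<alpha> * \<bar>\<eta>\<bar> < 1"
proof -
  have "L_tilde \<alpha> \<le> L" unfolding L_def L_tilde_eq by (rule sum_abs)
  then have L: "L \<ge> 1" using L_tilde_ge_1[OF assms(1,2)] by linarith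
  have t: "threshold \<alpha> \<eta> * (2 * (1 + L)) = 1 - L_tilde \<alpha> * \<bar>\<eta>\<bar>"
    using L unfolding threshold_def L_def[symmetric] by simp
  show pos: "threshold \<alpha> \<eta> > 0"
    using L assms(3) unfolding threshold_def L_def[symmetric] by simp
  have "L_tilde \<alpha> * \<bar>\<eta>\<bar> \<ge> 0" using L_tilde_ge_1[OF assms(1,2)] by simp
  moreover have "threshold \<alpha> \<eta> * 1 \<le> threshold \<alpha> \<eta> * L" using pos L by (intro mult_left_mono) auto
  ultimately show "threshold \<alpha> \<eta> < 1/2" "L * threshold \<alpha> \<eta> + L_tilde \<alpha> * \<bar>\<eta>\<bar> < 1"
    using t pos unfolding distrib_left mult.commute[of L] by linarith+
qed

text \<open>Enlarging the window by the factor \<open>Suc m\<^sub>0\<close> moves its start beyond \<open>m\<^sub>0\<close>, from where on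
  \<open>\<bar>\<xi>\<bar> * \<alpha> ^ m\<close> is large enough for \<open>far_index_in_window\<close>; the factor 2 makes consecutive
  windows disjoint. Since \<open>m\<^sub>0\<close> depends on \<open>\<xi>\<close> through the lower bound \<open>Y\<close> and the window ratio
  through the upper bound \<open>X\<close>, the constant \<open>C\<close> serves all \<open>\<xi>\<close> with \<open>Y \<le> \<bar>\<xi>\<bar> \<le> X\<close>.\<close>

lemma logarithmically_many_far_indices:
  fixes \<alpha> X Y :: real
  assumes alg: "algebraic \<alpha>" and \<alpha>: "\<alpha> > 1"
    and conj: "\<exists>\<beta>\<in>conjugates \<alpha>. \<beta> \<noteq> complex_of_real \<alpha> \<and> norm \<beta> > 1"
    and Y: "Y > 0"
  shows "\<exists>C>0. \<forall>\<eta> \<xi>. L_tilde \<alpha> * \<bar>\<eta>\<bar> < 1 \<longrightarrow> Y \<le> \<bar>\<xi>\<bar> \<longrightarrow> \<bar>\<xi>\<bar> \<le> X \<longrightarrow> (\<forall>N::nat. N \<ge> 1 \<longrightarrow>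
      int (card {n::nat. 1 \<le> n \<and> n \<le> N \<and> dist_int (\<xi> * \<alpha> ^ n - \<eta>) \<ge> threshold \<alpha> \<eta>})
        \<ge> \<lfloor>C * ln (real N)\<rfloor>)"
proof -
  let ?p = "min_int_poly \<alpha>"
  obtain \<beta> :: complex where \<beta>: "int_poly_at ?p \<beta> = 0" "\<beta> \<noteq> of_real \<alpha>" "norm \<beta> > 1"
    using conj by (auto simp: conjugates_def)
  note p = min_int_poly[OF alg]
  obtain D :: nat where D: "D \<ge> 1" and window: "\<And>\<xi> \<eta> \<delta> m. \<bar>\<xi>\<bar> \<le> max 0 X \<Longrightarrow> \<bar>\<eta>\<bar> \<le> 1 \<Longrightarrow> m \<ge> 1 \<Longrightarrow>
      \<bar>\<xi>\<bar> * \<alpha> ^ m > 3/2 \<Longrightarrow>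
      (\<Sum>j<Suc (degree ?p). \<bar>real_of_int (coeff ?p j)\<bar>) * \<delta>
        + \<bar>\<eta> * (\<Sum>j<Suc (degree ?p). real_of_int (coeff ?p j))\<bar> < 1 \<Longrightarrow>
      (\<exists>n\<in>{m..D * m}. dist_int (\<xi> * \<alpha> ^ n - \<eta>) \<ge> \<delta>)"
    using far_index_in_window[OF p(1,3) \<beta>(1) \<alpha> \<beta>(2,3), of "max 0 X"] by auto
  obtain m\<^sub>0 where m\<^sub>0: "3/2 / Y < \<alpha> ^ m\<^sub>0" using real_arch_pow[OF \<alpha>] by blast
  define F where "F = 2 * D * Suc m\<^sub>0"
  have F: "F \<ge> 2" using D by (simp add: F_def)
  show ?thesis
  proof (intro exI[of _ "1 / ln (real F)"] conjI allI impI)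
    show "1 / ln (real F) > 0" using F by simp
    fix \<eta> \<xi> :: real and N :: nat
    assume \<eta>: "L_tilde \<alpha> * \<bar>\<eta>\<bar> < 1" and \<xi>: "Y \<le> \<bar>\<xi>\<bar>" "\<bar>\<xi>\<bar> \<le> X" and N: "N \<ge> 1"
    have \<eta>1: "\<bar>\<eta>\<bar> \<le> 1"
      using \<eta> mult_right_mono[OF L_tilde_ge_1[OF alg], of "\<bar>\<eta>\<bar>"] \<alpha> by simp
    show "int (card {n::nat. 1 \<le> n \<and> n \<le> N \<and> dist_int (\<xi> * \<alpha> ^ n - \<eta>) \<ge> threshold \<alpha> \<eta>})
        \<ge> \<lfloor>1 / ln (real F) * ln (real N)\<rfloor>"
    proof (rule card_ge_floor_log_if_meets_blocks[OF F N])
      fix i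
      define m where "m = Suc m\<^sub>0 * F ^ i"
      have Fi: "F ^ i \<ge> 1" using F by simp
      then have m: "m \<ge> m\<^sub>0" "m \<ge> 1" "m \<ge> F ^ i"
        using mult_le_mono2[OF Fi, of "Suc m\<^sub>0"] by (auto simp: m_def)
      have "3/2 < Y * \<alpha> ^ m\<^sub>0" using m\<^sub>0 Y by (simp only: divide_less_eq mult.commute) simp
      also have "\<dots> \<le> \<bar>\<xi>\<bar> * \<alpha> ^ m"
        using \<xi> \<alpha> Y m by (intro mult_mono power_increasing) auto
      finally have big: "\<bar>\<xi>\<bar> * \<alpha> ^ m > 3/2" .
      have "\<exists>n\<in>{m..D * m}. dist_int (\<xi> * \<alpha> ^ n - \<eta>) \<ge> threshold \<alpha> \<eta>"
      proof (rule window[OF _ \<eta>1 m(2) big])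
        show "(\<Sum>j<Suc (degree ?p). \<bar>real_of_int (coeff ?p j)\<bar>) * threshold \<alpha> \<eta>
            + \<bar>\<eta> * (\<Sum>j<Suc (degree ?p). real_of_int (coeff ?p j))\<bar> < 1"
          using threshold_bounds(3)[OF alg _ \<eta>] \<alpha>
          unfolding abs_mult L_tilde_eq by (simp add: mult.commute)
      qed (use \<xi> in auto)
      then obtain n where n: "m \<le> n" "n \<le> D * m" "dist_int (\<xi> * \<alpha> ^ n - \<eta>) \<ge> threshold \<alpha> \<eta>"
        by auto
      have "D * m < 2 * (D * m)" using D m by simp
      also have "\<dots> = F ^ Suc i" by (simp add: F_def m_def mult_ac del: mult_Suc mult_Suc_right)
      finally show "\<exists>n. F ^ i \<le> n \<and> n < F ^ Suc i \<and> dist_int (\<xi> * \<alpha> ^ n - \<eta>) \<ge> threshold \<alpha> \<eta>"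
        using n m by (intro exI[of _ n]) auto
    qed
  qed
qed

text \<open>For the first part, \<open>X = Y = \<bar>\<xi>\<bar>\<close> gives a constant depending on \<open>\<xi>\<close> and not on \<open>\<eta>\<close>.
  For the second part, \<open>Y = 1\<close>, \<open>X = \<alpha>\<close> and \<open>\<eta> = 0\<close>.\<close>

theorem theorem1p7:
  fixes \<alpha> :: real
  assumes "algebraic \<alpha>" and "\<alpha> > 1"
    and "\<exists>\<beta>\<in>conjugates \<alpha>. \<beta> \<noteq> complex_of_real \<alpha> \<and> norm \<beta> > 1"
  shows "(\<exists>(\<delta>\<^sub>3 :: real \<Rightarrow> real) (C :: real \<Rightarrow> real).
            \<forall>\<eta> \<xi>. L_tilde \<alpha> * \<bar>\<eta>\<bar> < 1 \<longrightarrow> \<xi> \<noteq> 0 \<longrightarrow>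
              0 < \<delta>\<^sub>3 \<eta> \<and> \<delta>\<^sub>3 \<eta> < 1/2 \<and> C \<xi> > 0 \<and>
              (\<forall>N::nat. N \<ge> 1 \<longrightarrow>
                 int (card {n::nat. 1 \<le> n \<and> n \<le> N \<and> dist_int (\<xi> * \<alpha> ^ n - \<eta>) \<ge> \<delta>\<^sub>3 \<eta>})
                   \<ge> \<lfloor>C \<xi> * ln (real N)\<rfloor>))
       \<and> (\<exists>(\<delta>\<^sub>4 :: real) (C :: real).
            0 < \<delta>\<^sub>4 \<and> \<delta>\<^sub>4 < 1/2 \<and> C > 0 \<and>
            (\<forall>\<xi>. 1 \<le> \<xi> \<and> \<xi> \<le> \<alpha> \<longrightarrow>
              (\<forall>N::nat. N \<ge> 1 \<longrightarrow>
                 int (card {n::nat. 1 \<le> n \<and> n \<le> N \<and> dist_int (\<xi> * \<alpha> ^ n) \<ge> \<delta>\<^sub>4})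
                   \<ge> \<lfloor>C * ln (real N)\<rfloor>)))"
proof (intro conjI)
  have \<alpha>1: "\<alpha> \<noteq> 1" using assms(2) by simp
  note many = logarithmically_many_far_indices[OF assms]
  define far where "far \<xi> C \<longleftrightarrow> C > 0 \<and> (\<forall>\<eta>. L_tilde \<alpha> * \<bar>\<eta>\<bar> < 1 \<longrightarrow> (\<forall>N::nat. N \<ge> 1 \<longrightarrow>
      int (card {n::nat. 1 \<le> n \<and> n \<le> N \<and> dist_int (\<xi> * \<alpha> ^ n - \<eta>) \<ge> threshold \<alpha> \<eta>})
        \<ge> \<lfloor>C * ln (real N)\<rfloor>))" for \<xi> C
  have "\<exists>C. far \<xi> C" if "\<xi> \<noteq> 0" for \<xi>
    using many[of "\<bar>\<xi>\<bar>" "\<bar>\<xi>\<bar>"] that unfolding far_def by auto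
  then obtain C where C: "\<And>\<xi>. \<xi> \<noteq> 0 \<Longrightarrow> far \<xi> (C \<xi>)"
    by metis
  show "\<exists>(\<delta>\<^sub>3 :: real \<Rightarrow> real) (C :: real \<Rightarrow> real).
            \<forall>\<eta> \<xi>. L_tilde \<alpha> * \<bar>\<eta>\<bar> < 1 \<longrightarrow> \<xi> \<noteq> 0 \<longrightarrow>
              0 < \<delta>\<^sub>3 \<eta> \<and> \<delta>\<^sub>3 \<eta> < 1/2 \<and> C \<xi> > 0 \<and>
              (\<forall>N::nat. N \<ge> 1 \<longrightarrow>
                 int (card {n::nat. 1 \<le> n \<and> n \<le> N \<and> dist_int (\<xi> * \<alpha> ^ n - \<eta>) \<ge> \<delta>\<^sub>3 \<eta>})
                   \<ge> \<lfloor>C \<xi> * ln (real N)\<rfloor>)"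
  proof (rule exI[of _ "threshold \<alpha>"], rule exI[of _ C], intro allI impI)
    fix \<eta> \<xi> :: real
    assume \<eta>: "L_tilde \<alpha> * \<bar>\<eta>\<bar> < 1" and \<xi>: "\<xi> \<noteq> 0"
    show "0 < threshold \<alpha> \<eta> \<and> threshold \<alpha> \<eta> < 1/2 \<and> C \<xi> > 0 \<and>
              (\<forall>N::nat. N \<ge> 1 \<longrightarrow>
                 int (card {n::nat. 1 \<le> n \<and> n \<le> N \<and> dist_int (\<xi> * \<alpha> ^ n - \<eta>) \<ge> threshold \<alpha> \<eta>})
                   \<ge> \<lfloor>C \<xi> * ln (real N)\<rfloor>)"
      using C[OF \<xi>] \<eta> threshold_bounds(1,2)[OF assms(1) \<alpha>1 \<eta>] unfolding far_def by simp
  qed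
  obtain C where "C > 0" and C: "\<forall>\<eta> \<xi>. L_tilde \<alpha> * \<bar>\<eta>\<bar> < 1 \<longrightarrow> 1 \<le> \<bar>\<xi>\<bar> \<longrightarrow> \<bar>\<xi>\<bar> \<le> \<alpha> \<longrightarrow> (\<forall>N::nat. N \<ge> 1 \<longrightarrow>
      int (card {n::nat. 1 \<le> n \<and> n \<le> N \<and> dist_int (\<xi> * \<alpha> ^ n - \<eta>) \<ge> threshold \<alpha> \<eta>})
        \<ge> \<lfloor>C * ln (real N)\<rfloor>)"
    using many[OF zero_less_one, of \<alpha>] by (elim exE conjE) (rule that)
  show "\<exists>(\<delta>\<^sub>4 :: real) (C :: real).
            0 < \<delta>\<^sub>4 \<and> \<delta>\<^sub>4 < 1/2 \<and> C > 0 \<and>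
            (\<forall>\<xi>. 1 \<le> \<xi> \<and> \<xi> \<le> \<alpha> \<longrightarrow>
              (\<forall>N::nat. N \<ge> 1 \<longrightarrow>
                 int (card {n::nat. 1 \<le> n \<and> n \<le> N \<and> dist_int (\<xi> * \<alpha> ^ n) \<ge> \<delta>\<^sub>4})
                   \<ge> \<lfloor>C * ln (real N)\<rfloor>))"
  proof (rule exI[of _ "threshold \<alpha> 0"], rule exI[of _ C], intro conjI allI impI)
    show "0 < threshold \<alpha> 0" "threshold \<alpha> 0 < 1/2"
      using threshold_bounds(1,2)[OF assms(1) \<alpha>1, of 0] by simp_all
    show "C > 0" by fact
    fix \<xi> :: real and N :: nat
    assume "1 \<le> \<xi> \<and> \<xi> \<le> \<alpha>" "N \<ge> 1"
    then show "int (card {n::nat. 1 \<le> n \<and> n \<le> N \<and> dist_int (\<xi> * \<alpha> ^ n) \<ge> threshold \<alpha> 0})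
        \<ge> \<lfloor>C * ln (real N)\<rfloor>"
      using C[rule_format, of 0 \<xi> N] by simp
  qed
qed

end
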